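(* For any $n\geq1$, both $M_n(x)$ and $N_n(x)$ are alternatingly increasing; consequently each is unimodal, with a mode at index $\lfloor (d+1)/2\rfloor$ where $d$ is its degree (modes in the middle).
   Context: A Stirling permutation of order $n$ is a permutation $\sigma=\sigma_1\cdots\sigma_{2n}$ of the multiset $\{1,1,2,2,\ldots,n,n\}$ such that for each $i$ all entries between the two occurrences of $i$ are larger than $i$; $\mathcal{Q}_n$ is the set of these. Define ${\rm ap}(\sigma)=\#\{i\in[2,2n-1]:\sigma_{i-1}<\sigma_i=\sigma_{i+1}\}$ and ${\rm lap}(\sigma)=\#\{i\in[2n-1]:\sigma_{i-1}<\sigma_i=\sigma_{i+1}\}$ with the convention $\sigma_0=0$. Let $M_n(x)=\sum_{\sigma\in\mathcal{Q}_n}x^{{\rm ap}(\sigma)}$ and $N_n(x)=\sum_{\sigma\in\mathcal{Q}_n}x^{{\rm lap}(\sigma)}$. A polynomial $f(x)=\sum_{i=0}^d f_ix^i$ of degree $d$ is alternatingly increasing if $f_0\le f_d\le f_1\le f_{d-1}\le\cdots\le f_{\lfloor (d+1)/2\rfloor}$. It is unimodal if $f_0\le\cdots\le f_k\ge f_{k+1}\ge\cdots\ge f_d$ for some $k$ (a mode). *)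

theory Defs
  imports
    "HOL-Combinatorics.Multiset_Permutations"
    "HOL-Computational_Algebra.Polynomial"
begin

definition stirling_permutations :: "nat \<Rightarrow> nat list set" where
  "stirling_permutations n =
     {\<sigma> \<in> permutations_of_multiset (mset_set {1..n} + mset_set {1..n}).
        \<forall>a b c. a < b \<and> b < c \<and> c < length \<sigma> \<and> \<sigma> ! a = \<sigma> ! c \<longrightarrow> \<sigma> ! b > \<sigma> ! a}"

text \<open>
  Prepending 0 gives one-based indexing together with the convention that the entry
  at index 0 is 0.
\<close>

definition entry :: "nat list \<Rightarrow> nat \<Rightarrow> nat" where
  "entry \<sigma> i = (0 # \<sigma>) ! i"

definition ap :: "nat list \<Rightarrow> nat" where
  "ap \<sigma> = card {i \<in> {2..length \<sigma> - 1}.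
     entry \<sigma> (i - 1) < entry \<sigma> i \<and> entry \<sigma> i = entry \<sigma> (i + 1)}"

definition lap :: "nat list \<Rightarrow> nat" where
  "lap \<sigma> = card {i \<in> {1..length \<sigma> - 1}.
     entry \<sigma> (i - 1) < entry \<sigma> i \<and> entry \<sigma> i = entry \<sigma> (i + 1)}"

definition M_poly :: "nat \<Rightarrow> int poly" where
  "M_poly n = (\<Sum>\<sigma>\<in>stirling_permutations n. monom 1 (ap \<sigma>))"

definition N_poly :: "nat \<Rightarrow> int poly" where
  "N_poly n = (\<Sum>\<sigma>\<in>stirling_permutations n. monom 1 (lap \<sigma>))"

text \<open>
  For \<open>d = degree f\<close>, the chain \<open>f\<^sub>0 \<le> f\<^sub>d \<le> f\<^sub>1 \<le> f\<^sub>d\<^sub>-\<^sub>1 \<le> \<dots>\<close> up to index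
  \<open>\<lfloor>(d + 1) / 2\<rfloor>\<close>, given by its consecutive inequalities: the first conjunct lists the
  steps from \<open>i\<close> to \<open>d - i\<close>, the second those from \<open>d - i\<close> to \<open>i + 1\<close>. At the meeting
  point of the two ends the inequality is trivial.
\<close>

definition alternatingly_increasing :: "int poly \<Rightarrow> bool" where
  "alternatingly_increasing f \<longleftrightarrow>
     (\<forall>i. i \<le> degree f - i \<longrightarrow> coeff f i \<le> coeff f (degree f - i)) \<and>
     (\<forall>i. i + 1 \<le> degree f - i \<longrightarrow> coeff f (degree f - i) \<le> coeff f (i + 1))"

definition is_mode :: "int poly \<Rightarrow> nat \<Rightarrow> bool" where
  "is_mode f k \<longleftrightarrow> k \<le> degree f \<and>
     (\<forall>i<k. coeff f i \<le> coeff f (i + 1)) \<and>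
     (\<forall>i. k \<le> i \<and> i < degree f \<longrightarrow> coeff f i \<ge> coeff f (i + 1))"

definition unimodal :: "int poly \<Rightarrow> bool" where
  "unimodal f \<longleftrightarrow> (\<exists>k. is_mode f k)"

lemma finite_stirling_permutations [simp]: "finite (stirling_permutations n)"
  unfolding stirling_permutations_def by simp

end

theory Submission
  imports Defs "HOL-Library.Sublist"
begin

text \<open>
  Every Stirling permutation of order \<open>n + 1\<close> arises from a unique one of order \<open>n\<close> by inserting
  the block \<open>(n + 1)(n + 1)\<close>. The block always forms an ascent-plateau (for \<open>ap\<close>: unless it comes
  first), and it destroys an old one exactly when it is inserted directly before or inside a
  plateau preceded by an ascent. Hence the coefficients \<open>m n k\<close> of \<open>M\<^sub>n\<close> satisfy
  \<open>m (n + 1) k = (2k + 1) m n k + (2n - 2k + 2) m n (k - 1)\<close>, and those of \<open>N\<^sub>n\<close> satisfy the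
  recurrence that makes the coefficient of \<open>x\<^sup>k\<close> in \<open>N\<^sub>n\<close> equal to \<open>m n (n - k)\<close>. The inequalities
  \<open>m n i \<le> m n (n - 1 - i)\<close> and \<open>m n (n - i) \<le> m n i\<close> in the lower half follow from the recurrence
  by simultaneous induction, and together they say that both \<open>M\<^sub>n\<close> and \<open>N\<^sub>n\<close> are alternatingly
  increasing.
\<close>

section \<open>Ascent-plateaus\<close>

text \<open>The extra argument is the entry standing before the list: 0 there encodes the convention
  behind \<open>lap\<close>, and the first entry of a permutation there yields \<open>ap\<close> of
  the whole, which ignores a plateau at the very start.\<close>

fun ascent_plateaus :: "nat \<Rightarrow> nat list \<Rightarrow> nat" where
  "ascent_plateaus a (b # c # xs) = of_bool (a < b \<and> b = c) + ascent_plateaus b (c # xs)"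
| "ascent_plateaus a xs = 0"

lemma card_Collect_nat_split:
  assumes "finite {i::nat. P i}"
  shows "card {i. P i} = of_bool (P 0) + card {i. P (Suc i)}"
proof -
  have eq: "{i. P i} = (if P 0 then {0} else {}) \<union> Suc ` {i. P (Suc i)}"
    by (auto simp: image_iff gr0_conv_Suc split: if_splits) (metis not0_implies_Suc)+
  with assms have "finite (Suc ` {i. P (Suc i)})"
    by (metis finite_Un)
  then have "card {i. P i} = card (if P 0 then {0::nat} else {}) + card (Suc ` {i. P (Suc i)})"
    by (subst eq, subst card_Un_disjoint) auto
  then show ?thesis
    by (simp add: card_image)
qed

lemma ascent_plateaus_eq_card:
  "ascent_plateaus a xs =
     card {i. Suc i < length xs \<and> (a # xs) ! i < xs ! i \<and> xs ! i = xs ! Suc i}"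
proof (induction a xs rule: ascent_plateaus.induct)
  case (1 a b c xs)
  have "finite {i. Suc i < length (b # c # xs) \<and> (a # b # c # xs) ! i < (b # c # xs) ! i
      \<and> (b # c # xs) ! i = (b # c # xs) ! Suc i}"
    by (rule finite_subset[of _ "{..length (b # c # xs)}"]) auto
  from card_Collect_nat_split[OF this] 1 show ?case
    by simp
qed auto

lemma lap_eq_ascent_plateaus: "lap xs = ascent_plateaus 0 xs"
proof -
  have "{i \<in> {1..length xs - 1}. entry xs (i - 1) < entry xs i \<and> entry xs i = entry xs (i + 1)}
      = Suc ` {i. Suc i < length xs \<and> (0 # xs) ! i < xs ! i \<and> xs ! i = xs ! Suc i}"
    (is "?L = _ ` ?R")
  proof (intro equalityI subsetI)
    fix i assume "i \<in> ?L"
    then show "i \<in> Suc ` ?R"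
      by (cases i) (auto simp: entry_def)
  qed (auto simp: entry_def)
  then show ?thesis
    by (simp add: lap_def ascent_plateaus_eq_card card_image)
qed

lemma ap_Nil [simp]: "ap [] = 0"
  by (simp add: ap_def)

lemma ap_Cons: "ap (x # xs) = ascent_plateaus x xs"
proof -
  have "{i \<in> {2..length (x # xs) - 1}. entry (x # xs) (i - 1) < entry (x # xs) i
        \<and> entry (x # xs) i = entry (x # xs) (i + 1)}
      = (\<lambda>i. Suc (Suc i)) ` {i. Suc i < length xs \<and> (x # xs) ! i < xs ! i \<and> xs ! i = xs ! Suc i}"
    (is "?L = _ ` ?R")
  proof (intro equalityI subsetI)
    fix i assume i: "i \<in> ?L"
    then obtain j where "i = Suc (Suc j)"
      by (metis (no_types, lifting) One_nat_def Suc_1 atLeastAtMost_iff le_Suc_ex mem_Collect_eq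
          plus_nat.simps(2) plus_nat.simps(1))
    with i show "i \<in> (\<lambda>i. Suc (Suc i)) ` ?R"
      by (auto simp: entry_def)
  qed (auto simp: entry_def)
  moreover have "inj_on (\<lambda>i. Suc (Suc i)) ?R"
    by (auto simp: inj_on_def)
  ultimately show ?thesis
    by (simp add: ap_def ascent_plateaus_eq_card card_image)
qed

section \<open>Inserting the largest block\<close>

definition insert_block :: "nat \<Rightarrow> nat \<Rightarrow> nat list \<Rightarrow> nat list" where
  "insert_block m p xs = take p xs @ m # m # drop p xs"

lemma insert_block_0 [simp]: "insert_block m 0 xs = m # m # xs"
  by (simp add: insert_block_def)

lemma insert_block_Suc_Cons [simp]: "insert_block m (Suc p) (x # xs) = x # insert_block m p xs"
  by (simp add: insert_block_def)

lemma ascent_plateaus_descent: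
  assumes "b \<le> m"
  shows "ascent_plateaus m (b # xs) = ascent_plateaus b xs"
  using assms by (cases xs) auto

lemma ascent_plateaus_block:
  assumes "\<forall>x\<in>set xs. x < m"
  shows "ascent_plateaus a (m # m # xs) = of_bool (a < m) + ascent_plateaus m xs"
  using assms by (cases xs) auto

text \<open>Two gaps per ascent-plateau, directly before it and inside it, trade it for the new one;
  every other gap adds one. An arbitrary weight \<open>f\<close> lets the induction absorb shifts of
  the count.\<close>

lemma sum_ascent_plateaus_insert_block:
  fixes f :: "nat \<Rightarrow> int"
  assumes "\<forall>x\<in>set xs. x < m" and "a < m"
  shows "(\<Sum>p\<le>length xs. f (ascent_plateaus a (insert_block m p xs))) =
     2 * int (ascent_plateaus a xs) * f (ascent_plateaus a xs)
     + (int (length xs) + 1 - 2 * int (ascent_plateaus a xs)) * f (Suc (ascent_plateaus a xs))"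
  using assms
proof (induction xs arbitrary: a f)
  case Nil
  then show ?case by simp
next
  case (Cons b xs)
  have b: "b < m" and xs: "\<forall>x\<in>set xs. x < m"
    using Cons.prems by auto
  have first: "ascent_plateaus a (m # m # b # xs) = Suc (ascent_plateaus b xs)"
    using Cons.prems by (subst ascent_plateaus_block) (auto simp: ascent_plateaus_descent)
  show ?case
  proof (cases xs)
    case Nil
    then show ?thesis using b Cons.prems by simp
  next
    case (Cons c ys)
    \<comment> \<open>The contribution of the leading entry \<open>b\<close>; only the first two
      gaps can affect it.\<close>
    define d :: nat where "d = of_bool (a < b \<and> b = c)"
    have second: "ascent_plateaus a (b # m # m # xs) = ascent_plateaus b (m # m # xs)"
      using b by simp
    have rest: "ascent_plateaus a (b # insert_block m (Suc p) xs)
        = d + ascent_plateaus b (insert_block m (Suc p) xs)" for p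
      by (simp add: Cons d_def)
    have k: "ascent_plateaus a (b # xs) = d + ascent_plateaus b xs"
      by (simp add: Cons d_def)
    have len: "length xs = Suc (length ys)"
      by (simp add: Cons)
    have sum: "(\<Sum>p\<le>length (b # xs). f (ascent_plateaus a (insert_block m p (b # xs)))) =
        f (Suc (ascent_plateaus b xs)) + f (ascent_plateaus b (m # m # xs))
        + (\<Sum>p\<le>length ys. f (d + ascent_plateaus b (insert_block m (Suc p) xs)))"
      by (simp only: list.size(4) add_0_right add_Suc_right len sum.atMost_Suc_shift
          insert_block_0 insert_block_Suc_Cons first second rest add.assoc)
    \<comment> \<open>Shifting the weight by \<open>d\<close> accounts for the gaps beyond
      \<open>c\<close>. The term for gap 0 of \<open>xs\<close> is split off, since the block then
      separates \<open>b\<close> from \<open>c\<close>.\<close>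
    note IH = Cons.IH[OF xs b, of "\<lambda>j. f (d + j)",
        unfolded len sum.atMost_Suc_shift insert_block_0]
    show ?thesis
    proof (cases "d = 0")
      case True
      then show ?thesis
        unfolding sum k using IH by (simp add: len algebra_simps)
    next
      \<comment> \<open>The first two gaps lie before and inside the plateau of \<open>b\<close>, so
        both preserve the count.\<close>
      case False
      then have d: "d = 1" and "a < b" and "b = c"
        by (auto simp: d_def split: if_splits)
      have "ascent_plateaus m xs = ascent_plateaus b xs"
        using b \<open>b = c\<close> by (simp add: Cons ascent_plateaus_descent)
      then have "ascent_plateaus b (m # m # xs) = Suc (ascent_plateaus b xs)"
        using xs b by (simp add: ascent_plateaus_block del: ascent_plateaus.simps)
      then show ?thesis
        unfolding sum k using IH d by (simp add: len algebra_simps del: ascent_plateaus.simps)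
    qed
  qed
qed

lemma sum_lap_insert_block:
  fixes f :: "nat \<Rightarrow> int"
  assumes "\<forall>x\<in>set xs. x < m" and "0 < m"
  shows "(\<Sum>p\<le>length xs. f (lap (insert_block m p xs))) =
     2 * int (lap xs) * f (lap xs) + (int (length xs) + 1 - 2 * int (lap xs)) * f (Suc (lap xs))"
  using sum_ascent_plateaus_insert_block[OF assms] by (simp add: lap_eq_ascent_plateaus)

text \<open>A block in front sits where \<open>ap\<close> does not count and breaks nothing, which
  gives one more neutral gap. The other gaps are those of the tail, with the first entry as
  predecessor.\<close>

lemma sum_ap_insert_block:
  fixes f :: "nat \<Rightarrow> int"
  assumes "\<forall>x\<in>set xs. x < m"
  shows "(\<Sum>p\<le>length xs. f (ap (insert_block m p xs))) =
     (2 * int (ap xs) + 1) * f (ap xs) + (int (length xs) - 2 * int (ap xs)) * f (Suc (ap xs))"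
proof (cases xs)
  case Nil
  then show ?thesis by (simp add: ap_Cons)
next
  case (Cons x ys)
  have x: "x < m" and ys: "\<forall>y\<in>set ys. y < m"
    using assms Cons by auto
  have "ap (m # m # x # ys) = ap (x # ys)"
    using x by (simp add: ap_Cons ascent_plateaus_descent)
  then show ?thesis
    using sum_ascent_plateaus_insert_block[OF ys x, of f]
    by (simp add: Cons sum.atMost_Suc_shift ap_Cons algebra_simps del: sum.atMost_Suc)
qed

section \<open>Stirling permutations through subsequences\<close>

lemma subseq_three_iff:
  "subseq [x, y, z] xs \<longleftrightarrow>
     (\<exists>a b c. a < b \<and> b < c \<and> c < length xs \<and> xs ! a = x \<and> xs ! b = y \<and> xs ! c = z)"
proof
  assume "subseq [x, y, z] xs"
  then obtain us vs ws zs where "xs = us @ x # vs @ y # ws @ z # zs"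
    by (auto dest!: list_emb_ConsD)
  then show "\<exists>a b c. a < b \<and> b < c \<and> c < length xs \<and> xs ! a = x \<and> xs ! b = y \<and> xs ! c = z"
    by (intro exI[of _ "length us"] exI[of _ "length us + Suc (length vs)"]
        exI[of _ "length us + Suc (length vs) + Suc (length ws)"])
      (auto simp: nth_append)
next
  assume "\<exists>a b c. a < b \<and> b < c \<and> c < length xs \<and> xs ! a = x \<and> xs ! b = y \<and> xs ! c = z"
  then obtain a b c where abc: "a < b" "b < c" "c < length xs"
    and [simp]: "xs ! a = x" "xs ! b = y" "xs ! c = z"
    by blast
  have "xs = take a xs @ x # drop (Suc a) xs"
    using abc id_take_nth_drop[of a xs] by simp
  moreover have "drop (Suc a) xs = take (b - Suc a) (drop (Suc a) xs) @ y # drop (Suc b) xs"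
    using abc id_take_nth_drop[of "b - Suc a" "drop (Suc a) xs"] by simp
  moreover have "drop (Suc b) xs = take (c - Suc b) (drop (Suc b) xs) @ z # drop (Suc c) xs"
    using abc id_take_nth_drop[of "c - Suc b" "drop (Suc b) xs"] by simp
  ultimately obtain us vs ws zs where "xs = us @ x # vs @ y # ws @ z # zs"
    by metis
  then show "subseq [x, y, z] xs"
    by (simp add: subseq_drop_many list_emb_append2)
qed

lemma subseq_Cons_append_notin:
  assumes "subseq (x # zs) (us @ vs)" and "x \<notin> set us"
  shows "subseq (x # zs) vs"
  using assms by (induction us) (auto split: if_splits)

text \<open>Phrased by subsequences, the pattern condition passes to sublists and through filters
  without index shifting.\<close>

lemma stirling_permutations_iff:
  "xs \<in> stirling_permutations n \<longleftrightarrow>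
     mset xs = mset_set {1..n} + mset_set {1..n} \<and> (\<forall>x y. subseq [x, y, x] xs \<longrightarrow> x < y)"
  unfolding stirling_permutations_def permutations_of_multiset_def subseq_three_iff
  by (simp only: mem_Collect_eq) metis

lemma set_stirling_permutation:
  assumes "xs \<in> stirling_permutations n"
  shows "set xs = {1..n}"
proof -
  have "set_mset (mset xs) = set_mset (mset_set {1..n} + mset_set {1..n})"
    using assms by (simp only: stirling_permutations_iff)
  then show ?thesis by simp
qed

lemma length_stirling_permutation:
  assumes "xs \<in> stirling_permutations n"
  shows "length xs = 2 * n"
proof -
  have "size (mset xs) = size (mset_set {1..n} + mset_set {1..n})"
    using assms by (simp only: stirling_permutations_iff)
  then show ?thesis by simp
qed

section \<open>The bijection given by insertion and removal of the largest block\<close>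

lemma mset_set_atLeastAtMost_Suc:
  "mset_set {Suc 0..Suc n} = add_mset (Suc n) (mset_set {Suc 0..n})"
  by (simp add: atLeastAtMostSuc_conv)

lemma mset_insert_block: "mset (insert_block m p xs) = add_mset m (add_mset m (mset xs))"
  by (simp add: insert_block_def) (metis append_take_drop_id mset_append)

lemma filter_insert_block:
  assumes "m \<notin> set xs"
  shows "filter (\<lambda>x. x \<noteq> m) (insert_block m p xs) = xs"
proof -
  have "filter (\<lambda>x. x \<noteq> m) (take p xs) = take p xs" "filter (\<lambda>x. x \<noteq> m) (drop p xs) = drop p xs"
    using assms by (auto intro!: filter_True dest: in_set_takeD in_set_dropD)
  then show ?thesis by (simp add: insert_block_def)
qed

lemma length_takeWhile_insert_block:
  assumes "m \<notin> set xs" and "p \<le> length xs"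
  shows "length (takeWhile (\<lambda>x. x \<noteq> m) (insert_block m p xs)) = p"
proof -
  have "\<forall>x\<in>set (take p xs). x \<noteq> m"
    using assms(1) by (auto dest: in_set_takeD)
  then have "takeWhile (\<lambda>x. x \<noteq> m) (insert_block m p xs) = take p xs"
    by (simp add: insert_block_def takeWhile_append2)
  with assms(2) show ?thesis by simp
qed

text \<open>In a pattern \<open>[x, y, x]\<close> the new value cannot be \<open>x\<close>, its
  copies being adjacent; as \<open>y\<close> it exceeds every old entry; and a pattern avoiding it
  survives its deletion, so it already occurs in \<open>xs\<close>.\<close>

lemma insert_block_stirling_permutation:
  assumes xs: "xs \<in> stirling_permutations n"
  shows "insert_block (Suc n) p xs \<in> stirling_permutations (Suc n)"
  unfolding stirling_permutations_iff
proof (intro conjI allI impI)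
  show "mset (insert_block (Suc n) p xs) = mset_set {1..Suc n} + mset_set {1..Suc n}"
    using xs by (simp add: mset_insert_block mset_set_atLeastAtMost_Suc stirling_permutations_iff)
next
  fix x y assume sub: "subseq [x, y, x] (insert_block (Suc n) p xs)"
  have new: "Suc n \<notin> set xs"
    using set_stirling_permutation[OF xs] by simp
  have "x \<in> set (insert_block (Suc n) p xs)"
    using list_emb_set[OF sub, of x] by auto
  moreover have "set (insert_block (Suc n) p xs) = insert (Suc n) {1..n}"
    using arg_cong[OF mset_insert_block[of "Suc n" p xs], of set_mset]
    by (simp add: set_stirling_permutation[OF xs])
  ultimately have x: "x \<le> Suc n" by auto
  have x': "x \<noteq> Suc n"
  proof
    assume xn: "x = Suc n"
    have "Suc n \<notin> set (take p xs)" and 2: "Suc n \<notin> set (drop p xs)"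
      using new by (auto dest: in_set_takeD in_set_dropD)
    then have "subseq [x, y, x] (Suc n # Suc n # drop p xs)"
      using sub xn unfolding insert_block_def by (blast intro: subseq_Cons_append_notin)
    then have "subseq [y, x] (Suc n # drop p xs)"
      using xn by simp
    \<comment> \<open>Whether or not \<open>y\<close> uses up the second copy, the last
      \<open>x\<close> must occur after the block.\<close>
    then have "subseq [x] (drop p xs)"
      using xn by (auto split: if_splits dest: subseq_Cons')
    then show False
      using 2 xn by (simp add: subseq_singleton_left)
  qed
  show "x < y"
  proof (cases "y = Suc n")
    case True
    then show ?thesis using x x' by simp
  next
    case False
    have "subseq (filter (\<lambda>x. x \<noteq> Suc n) [x, y, x])
        (filter (\<lambda>x. x \<noteq> Suc n) (insert_block (Suc n) p xs))"
      using sub by (rule subseq_filter)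
    then have "subseq [x, y, x] xs"
      using x' False new by (simp add: filter_insert_block)
    then show ?thesis using xs by (simp add: stirling_permutations_iff)
  qed
qed

text \<open>An entry between the two copies of the maximum would have to exceed it.\<close>

lemma stirling_permutation_Suc_split:
  assumes ys: "ys \<in> stirling_permutations (Suc n)"
  obtains us vs where "ys = us @ Suc n # Suc n # vs" "Suc n \<notin> set us" "Suc n \<notin> set vs"
proof -
  have "count (mset ys) (Suc n) = 2"
    using ys by (simp add: stirling_permutations_iff)
  then have "Suc n \<in> set ys"
    by (metis count_mset_0_iff zero_neq_numeral)
  then obtain us zs where 1: "ys = us @ Suc n # zs" "Suc n \<notin> set us"
    by (metis split_list_first)
  with \<open>count (mset ys) (Suc n) = 2\<close> have cz: "count (mset zs) (Suc n) = 1"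
    by (simp add: count_mset_0_iff[THEN iffD2])
  then have "Suc n \<in> set zs"
    by (metis count_mset_0_iff zero_neq_one)
  then obtain ws vs where 2: "zs = ws @ Suc n # vs" "Suc n \<notin> set ws"
    by (metis split_list_first)
  have "ws = []"
  proof (cases ws)
    case (Cons w ws')
    then have "subseq [Suc n, w, Suc n] ys"
      using 1 2 by (simp add: subseq_drop_many list_emb_append2)
    then have "Suc n < w"
      using ys by (simp add: stirling_permutations_iff)
    moreover have "w \<in> set ys"
      using 1 2 Cons by simp
    ultimately show ?thesis
      using set_stirling_permutation[OF ys] by auto
  qed
  moreover have "Suc n \<notin> set vs"
    using cz 2 by (simp add: count_mset_0_iff[THEN iffD2])
  ultimately show ?thesis
    using that 1 2 by simp
qed

lemma remove_block_stirling_permutation: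
  assumes ys: "ys \<in> stirling_permutations (Suc n)"
  defines "xs \<equiv> filter (\<lambda>x. x \<noteq> Suc n) ys"
    and "p \<equiv> length (takeWhile (\<lambda>x. x \<noteq> Suc n) ys)"
  shows "xs \<in> stirling_permutations n" and "p \<le> length xs" and "insert_block (Suc n) p xs = ys"
proof -
  from stirling_permutation_Suc_split[OF ys] obtain us vs
    where eq: "ys = us @ Suc n # Suc n # vs" and us: "Suc n \<notin> set us" and vs: "Suc n \<notin> set vs"
    by metis
  have "filter (\<lambda>x. x \<noteq> Suc n) us = us" "filter (\<lambda>x. x \<noteq> Suc n) vs = vs"
    using us vs by (auto intro!: filter_True)
  then have xs: "xs = us @ vs"
    by (simp add: xs_def eq)
  have "\<forall>x\<in>set us. x \<noteq> Suc n" using us by auto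
  then have p: "p = length us"
    by (simp add: p_def eq takeWhile_append2)
  show "p \<le> length xs" "insert_block (Suc n) p xs = ys"
    by (simp_all add: xs p eq insert_block_def)
  have "mset xs = mset_set {1..n} + mset_set {1..n}"
    using ys by (simp add: stirling_permutations_iff eq xs mset_set_atLeastAtMost_Suc)
  \<comment> \<open>Deletion yields a subsequence, so every pattern of \<open>xs\<close> is one of
    \<open>ys\<close>.\<close>
  moreover have "subseq xs ys"
    unfolding xs_def by simp
  then have "\<forall>x y. subseq [x, y, x] xs \<longrightarrow> x < y"
    using ys subseq_order.order_trans unfolding stirling_permutations_iff by blast
  ultimately show "xs \<in> stirling_permutations n"
    by (simp add: stirling_permutations_iff)
qed

lemma sum_stirling_permutations_Suc:
  fixes f :: "nat list \<Rightarrow> int"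
  shows "(\<Sum>ys\<in>stirling_permutations (Suc n). f ys) =
     (\<Sum>xs\<in>stirling_permutations n. \<Sum>p\<le>length xs. f (insert_block (Suc n) p xs))"
proof -
  have new: "Suc n \<notin> set xs" if "xs \<in> stirling_permutations n" for xs
    using set_stirling_permutation[OF that] by simp
  have "(\<Sum>ys\<in>stirling_permutations (Suc n). f ys) =
      (\<Sum>(xs, p)\<in>(SIGMA xs:stirling_permutations n. {..length xs}). f (insert_block (Suc n) p xs))"
    by (rule sum.reindex_bij_witness[where
          i = "\<lambda>(xs, p). insert_block (Suc n) p xs" and
          j = "\<lambda>ys. (filter (\<lambda>x. x \<noteq> Suc n) ys, length (takeWhile (\<lambda>x. x \<noteq> Suc n) ys))"])
      (auto simp: remove_block_stirling_permutation insert_block_stirling_permutation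
        filter_insert_block length_takeWhile_insert_block new)
  then show ?thesis
    by (simp add: sum.Sigma)
qed

section \<open>Coefficients\<close>

text \<open>The 1/2-Eulerian numbers. The recurrence is written at index \<open>k + 1\<close> to
  avoid natural subtraction; over the integers the factor \<open>2 * int n - 2 * int k\<close> may
  be negative, but only where it multiplies zero.\<close>

fun ap_number :: "nat \<Rightarrow> nat \<Rightarrow> int" where
  "ap_number 0 k = of_bool (k = 0)"
| "ap_number (Suc n) 0 = ap_number n 0"
| "ap_number (Suc n) (Suc k) =
     (2 * int k + 3) * ap_number n (Suc k) + (2 * int n - 2 * int k) * ap_number n k"

lemma stirling_permutations_0: "stirling_permutations 0 = {[]}"
  by (auto simp: stirling_permutations_iff)

lemma coeff_M_poly_sum: "coeff (M_poly n) k = (\<Sum>xs\<in>stirling_permutations n. of_bool (ap xs = k))"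
  by (simp add: M_poly_def coeff_sum of_bool_def)

lemma coeff_N_poly_sum: "coeff (N_poly n) k = (\<Sum>xs\<in>stirling_permutations n. of_bool (lap xs = k))"
  by (simp add: N_poly_def coeff_sum of_bool_def)

lemma coeff_M_poly_Suc:
  "coeff (M_poly (Suc n)) k = (2 * int k + 1) * coeff (M_poly n) k
     + (if k = 0 then 0 else (2 * int n - 2 * int k + 2) * coeff (M_poly n) (k - 1))"
proof -
  have "coeff (M_poly (Suc n)) k = (\<Sum>xs\<in>stirling_permutations n.
      (2 * int (ap xs) + 1) * of_bool (ap xs = k)
      + (2 * int n - 2 * int (ap xs)) * of_bool (Suc (ap xs) = k))"
    unfolding coeff_M_poly_sum sum_stirling_permutations_Suc
  proof (rule sum.cong[OF refl])
    fix xs assume xs: "xs \<in> stirling_permutations n"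
    have "\<forall>x\<in>set xs. x < Suc n"
      using set_stirling_permutation[OF xs] by auto
    from sum_ap_insert_block[OF this, of "\<lambda>j. of_bool (j = k)"]
    show "(\<Sum>p\<le>length xs. of_bool (ap (insert_block (Suc n) p xs) = k)) =
        (2 * int (ap xs) + 1) * of_bool (ap xs = k)
        + (2 * int n - 2 * int (ap xs)) * of_bool (Suc (ap xs) = k)"
      by (simp add: length_stirling_permutation[OF xs])
  qed
  \<comment> \<open>\<open>Suc (ap xs) = k\<close> is impossible for \<open>k = 0\<close>; otherwise
    \<open>ap xs\<close> is \<open>k - 1\<close>, whence the constant 2 in the second
    factor.\<close>
  also have "\<dots> = (\<Sum>xs\<in>stirling_permutations n. (2 * int k + 1) * of_bool (ap xs = k)
      + (if k = 0 then 0 else (2 * int n - 2 * int k + 2) * of_bool (ap xs = k - 1)))"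
    by (intro sum.cong) auto
  finally show ?thesis
    by (simp add: sum.distrib coeff_M_poly_sum sum_distrib_left)
qed

lemma coeff_N_poly_Suc:
  "coeff (N_poly (Suc n)) k = 2 * int k * coeff (N_poly n) k
     + (if k = 0 then 0 else (2 * int n - 2 * int k + 3) * coeff (N_poly n) (k - 1))"
proof -
  have "coeff (N_poly (Suc n)) k = (\<Sum>xs\<in>stirling_permutations n.
      2 * int (lap xs) * of_bool (lap xs = k)
      + (2 * int n + 1 - 2 * int (lap xs)) * of_bool (Suc (lap xs) = k))"
    unfolding coeff_N_poly_sum sum_stirling_permutations_Suc
  proof (rule sum.cong[OF refl])
    fix xs assume xs: "xs \<in> stirling_permutations n"
    have "\<forall>x\<in>set xs. x < Suc n"
      using set_stirling_permutation[OF xs] by auto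
    from sum_lap_insert_block[OF this, of "\<lambda>j. of_bool (j = k)"]
    show "(\<Sum>p\<le>length xs. of_bool (lap (insert_block (Suc n) p xs) = k)) =
        2 * int (lap xs) * of_bool (lap xs = k)
        + (2 * int n + 1 - 2 * int (lap xs)) * of_bool (Suc (lap xs) = k)"
      by (simp add: length_stirling_permutation[OF xs])
  qed
  also have "\<dots> = (\<Sum>xs\<in>stirling_permutations n. 2 * int k * of_bool (lap xs = k)
      + (if k = 0 then 0 else (2 * int n - 2 * int k + 3) * of_bool (lap xs = k - 1)))"
    by (intro sum.cong) auto
  finally show ?thesis
    by (simp add: sum.distrib coeff_N_poly_sum sum_distrib_left)
qed

lemma coeff_M_poly: "coeff (M_poly n) k = ap_number n k"
proof (induction n arbitrary: k)
  case 0
  then show ?case by (simp add: coeff_M_poly_sum stirling_permutations_0)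
next
  case (Suc n)
  then show ?case by (cases k) (simp_all add: coeff_M_poly_Suc algebra_simps)
qed

lemma ap_number_eq_0:
  assumes "n \<le> k" and "0 < k"
  shows "ap_number n k = 0"
  using assms
proof (induction n arbitrary: k)
  case (Suc n)
  then obtain j where k: "k = Suc j" by (cases k) auto
  \<comment> \<open>For \<open>j = n\<close> the factor \<open>2 * int n - 2 * int j\<close>
    vanishes; this covers \<open>j = n = 0\<close>, where the induction hypothesis says
    nothing.\<close>
  show ?case
    using Suc by (cases "j = n") (auto simp: k)
qed auto

text \<open>This top coefficient doubles at each step; its positivity fixes the degree of
  \<open>M_poly\<close>.\<close>

lemma ap_number_last_pos: "0 < ap_number (Suc n) n"
proof (induction n)
  case (Suc n)
  have "ap_number (Suc (Suc n)) (Suc n) = 2 * ap_number (Suc n) n"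
    by (subst ap_number.simps(3)) (simp add: ap_number_eq_0 del: ap_number.simps)
  with Suc show ?case by (simp del: ap_number.simps)
qed simp

lemma ap_number_0_right [simp]: "ap_number n 0 = 1"
  by (induction n) auto

text \<open>Reflecting \<open>k\<close> to \<open>n - k\<close> at order \<open>n\<close>, and to
  \<open>n + 1 - k\<close> at order \<open>n + 1\<close>, swaps the two terms of the recurrence for
  \<open>ap_number\<close> and turns it into the one for \<open>N_poly\<close>.\<close>

lemma coeff_N_poly: "coeff (N_poly n) k = (if k \<le> n then ap_number n (n - k) else 0)"
proof (induction n arbitrary: k)
  case 0
  then show ?case
    by (auto simp: coeff_N_poly_sum stirling_permutations_0 lap_eq_ascent_plateaus)
next
  case (Suc n)
  consider "k = 0" | "0 < k" "k \<le> n" | "k = Suc n" | "k > Suc n" by linarith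
  then show ?case
  proof cases
    case 1
    then show ?thesis
      by (simp add: coeff_N_poly_Suc ap_number_eq_0 del: ap_number.simps)
  next
    case 2
    then obtain j where j: "n = k + j" by (metis le_Suc_ex)
    have "Suc n - k = Suc j" "n - k = j" "n - (k - 1) = Suc j"
      using j 2 by auto
    then show ?thesis
      using 2 Suc by (simp add: coeff_N_poly_Suc j algebra_simps)
  next
    case 3
    then show ?thesis using Suc by (simp add: coeff_N_poly_Suc)
  next
    case 4
    then show ?thesis using Suc by (simp add: coeff_N_poly_Suc)
  qed
qed

section \<open>Degrees\<close>

lemma degree_M_poly: "degree (M_poly (Suc n)) = n"
proof (rule antisym)
  show "degree (M_poly (Suc n)) \<le> n"
    by (rule degree_le) (simp add: coeff_M_poly ap_number_eq_0 del: ap_number.simps)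
  show "n \<le> degree (M_poly (Suc n))"
    using ap_number_last_pos[of n] by (intro le_degree) (simp add: coeff_M_poly)
qed

lemma degree_N_poly: "degree (N_poly n) = n"
proof (rule antisym)
  show "degree (N_poly n) \<le> n"
    by (rule degree_le) (simp add: coeff_N_poly)
  show "n \<le> degree (N_poly n)"
    by (intro le_degree) (simp add: coeff_N_poly)
qed

section \<open>Alternating increase\<close>

lemma ap_number_Suc:
  assumes "0 < k"
  shows "ap_number (Suc n) k = (2 * int k + 1) * ap_number n k
    + (2 * int n - 2 * int k + 2) * ap_number n (k - 1)"
  using assms by (cases k) (simp_all add: algebra_simps)

text \<open>The two families are the two kinds of steps in the chain for \<open>M_poly\<close>, and
  in swapped roles those for \<open>N_poly\<close>. Each one at \<open>n + 1\<close> needs both at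
  \<open>n\<close>.\<close>

lemma ap_number_alternating:
  "(\<forall>i. 2 * i + 1 \<le> n \<longrightarrow> ap_number n i \<le> ap_number n (n - 1 - i)) \<and>
   (\<forall>i. 2 * i \<le> n \<longrightarrow> ap_number n (n - i) \<le> ap_number n i)"
proof (induction n)
  case 0
  then show ?case by simp
next
  case (Suc n)
  have A: "ap_number n i \<le> ap_number n j" if "Suc (i + j) = n" "i \<le> j" for i j
    using Suc that by (metis (no_types, lifting) Suc_eq_plus1 add_diff_cancel_left' add_le_mono
        diff_Suc_1 mult_2 nat_add_left_cancel_le not_less_eq_eq)
  have B: "ap_number n j \<le> ap_number n i" if "i + j = n" "i \<le> j" for i j
    using Suc that by (metis add_diff_cancel_left' add_le_mono le_refl mult_2)
  have A': "ap_number (Suc n) i \<le> ap_number (Suc n) j" if ij: "i + j = n" "i \<le> j" for i j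
  proof -
    consider "i = j" | "i < j" "i = 0" | i' where "i < j" "i = Suc i'"
      using ij(2) by (metis gr0_implies_Suc le_neq_implies_less neq0_conv)
    then show ?thesis
    proof cases
      \<comment> \<open>Here \<open>j = n\<close>: the left side is 1 and the right side is twice
        the positive number \<open>ap_number n (n - 1)\<close>.\<close>
      case 2
      have "1 \<le> ap_number n (j - 1)"
        using A[of 0 "j - 1"] ij 2 by simp
      moreover have "ap_number n j = 0"
        using ij 2 by (simp add: ap_number_eq_0)
      ultimately show ?thesis
        using ij 2 by (simp add: ap_number_Suc)
    next
      case (3 i')
      obtain j' where j: "j = Suc j'" using 3 by (cases j) auto
      have le: "ap_number n i' \<le> ap_number n j" "ap_number n j \<le> ap_number n i"
        "ap_number n i \<le> ap_number n j'"
        using A[of i' j] B[of i j] A[of i j'] ij 3 j by auto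
      \<comment> \<open>With \<open>m\<close> for \<open>ap_number n\<close>, right minus left is
        \<open>(2j+1)(m j - m i') + (2i+1)(m j' - m i) + (m j' - m i')\<close>, and
        \<open>m i' \<le> m j \<le> m i \<le> m j'\<close>.\<close>
      have "(2 * int j + 1) * (ap_number n j - ap_number n i') \<ge> 0"
        "(2 * int i + 1) * (ap_number n j' - ap_number n i) \<ge> 0"
        using le by simp_all
      moreover have "int n = int i + int j" using ij by simp
      ultimately show ?thesis
        using le 3 j by (simp add: ap_number_Suc algebra_simps)
    qed simp
  qed
  have B': "ap_number (Suc n) j \<le> ap_number (Suc n) i" if ij: "i + j = Suc n" "i \<le> j" for i j
  proof -
    consider "i = j" | "i < j" "i = 0" | i' where "i < j" "i = Suc i'"
      using ij(2) by (metis gr0_implies_Suc le_neq_implies_less neq0_conv)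
    then show ?thesis
    proof cases
      case 2
      then show ?thesis using ij by (simp add: ap_number_eq_0 del: ap_number.simps)
    next
      case (3 i')
      obtain j' where j: "j = Suc j'" using 3 by (cases j) auto
      have le: "ap_number n j' \<le> ap_number n i" "ap_number n j \<le> ap_number n i'"
        "ap_number n i' \<le> ap_number n j'"
        using B[of i j'] B[of i' j] A[of i' j'] ij 3 j by auto
      \<comment> \<open>Now right minus left is
        \<open>2i(m i - m j') + 2j(m i' - m j) + (m i - m j)\<close>, and
        \<open>m j \<le> m i' \<le> m j' \<le> m i\<close>.\<close>
      have "2 * int i * (ap_number n i - ap_number n j') \<ge> 0"
        "2 * int j * (ap_number n i' - ap_number n j) \<ge> 0"
        using le by simp_all
      moreover have "int n = int i + int j - 1" using ij by simp
      ultimately show ?thesis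
        using le 3 j by (simp add: ap_number_Suc algebra_simps)
    qed simp
  qed
  show ?case
    using A' B' by (auto simp del: ap_number.simps)
qed

lemma ap_number_le_lower:
  assumes "Suc (i + j) = n" and "i \<le> j"
  shows "ap_number n i \<le> ap_number n j"
  using ap_number_alternating[of n] assms by (auto dest!: spec[of _ i] simp del: ap_number.simps)

lemma ap_number_le_upper:
  assumes "i + j = n" and "i \<le> j"
  shows "ap_number n j \<le> ap_number n i"
  using ap_number_alternating[of n] assms by (auto dest!: spec[of _ i] simp del: ap_number.simps)

lemma alternatingly_increasing_M_poly: "alternatingly_increasing (M_poly (Suc n))"
  unfolding alternatingly_increasing_def degree_M_poly coeff_M_poly
proof (intro conjI allI impI)
  fix i
  show "ap_number (Suc n) i \<le> ap_number (Suc n) (n - i)" if "i \<le> n - i"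
    using that by (intro ap_number_le_lower) auto
  show "ap_number (Suc n) (n - i) \<le> ap_number (Suc n) (i + 1)" if "i + 1 \<le> n - i"
    using that by (intro ap_number_le_upper) auto
qed

text \<open>The coefficients are those of \<open>ap_number n\<close> reversed, so the upper
  inequality gives the steps from \<open>i\<close> to \<open>n - i\<close> and the lower one those
  from \<open>n - i\<close> to \<open>i + 1\<close>.\<close>

lemma alternatingly_increasing_N_poly: "alternatingly_increasing (N_poly n)"
  unfolding alternatingly_increasing_def degree_N_poly coeff_N_poly
proof (intro conjI allI impI)
  fix i
  show "(if i \<le> n then ap_number n (n - i) else 0)
      \<le> (if n - i \<le> n then ap_number n (n - (n - i)) else 0)" if "i \<le> n - i"
    using that ap_number_le_upper[of i "n - i" n] by (cases "i \<le> n") auto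
  show "(if n - i \<le> n then ap_number n (n - (n - i)) else 0)
      \<le> (if i + 1 \<le> n then ap_number n (n - (i + 1)) else 0)" if "i + 1 \<le> n - i"
    using that ap_number_le_lower[of i "n - (i + 1)" n] by (cases "i + 1 \<le> n") auto
qed

section \<open>From alternating increase to a mode in the middle\<close>

lemma alternatingly_increasing_imp_is_mode:
  assumes "alternatingly_increasing f"
  shows "is_mode f ((degree f + 1) div 2)"
proof -
  define d where "d = degree f"
  have up: "coeff f i \<le> coeff f j" if "i + j = d" "i \<le> j" for i j
    using assms that unfolding alternatingly_increasing_def d_def[symmetric]
    by (auto dest!: spec[of _ i])
  have down: "coeff f j \<le> coeff f (Suc i)" if "i + j = d" "i < j" for i j
    using assms that unfolding alternatingly_increasing_def d_def[symmetric]
    by (auto dest!: spec[of _ i])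
  have "coeff f i \<le> coeff f (i + 1)" if "i < (d + 1) div 2" for i
  proof -
    \<comment> \<open>Left of the middle, two consecutive chain steps pass through the coefficient
      at \<open>d - i\<close>.\<close>
    have "i < d - i" and "i + (d - i) = d"
      using that by auto
    then show ?thesis
      using up[of i "d - i"] down[of i "d - i"] by simp
  qed
  moreover have "coeff f (i + 1) \<le> coeff f i" if "(d + 1) div 2 \<le> i" "i < d" for i
  proof -
    \<comment> \<open>Right of the middle the chain is entered at the reflection
      \<open>d - i - 1\<close> of \<open>i + 1\<close>: the coefficient at \<open>i + 1\<close> is
      at most that at \<open>d - i\<close>, which is at most that at \<open>i\<close>.\<close>
    have "d - i - 1 < i + 1" and "d - i - 1 + (i + 1) = d" and "d - i \<le> i"
      and "Suc (d - i - 1) = d - i"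
      using that by auto
    then show ?thesis
      using down[of "d - i - 1" "i + 1"] up[of "d - i" i] that
      by (simp del: diff_diff_left)
  qed
  ultimately show ?thesis
    unfolding is_mode_def d_def[symmetric] by auto
qed

theorem theorem2p7:
  fixes n :: nat
  assumes "n \<ge> 1"
  shows "alternatingly_increasing (M_poly n) \<and> alternatingly_increasing (N_poly n) \<and>
    unimodal (M_poly n) \<and> is_mode (M_poly n) ((degree (M_poly n) + 1) div 2) \<and>
    unimodal (N_poly n) \<and> is_mode (N_poly n) ((degree (N_poly n) + 1) div 2)"
proof -
  from assms have "alternatingly_increasing (M_poly n)"
    using alternatingly_increasing_M_poly[of "n - 1"] by simp
  then show ?thesis
    using alternatingly_increasing_N_poly alternatingly_increasing_imp_is_mode
    unfolding unimodal_def by blast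
qed

end
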